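(* Let $k\ge 2$ be a constant integer. Consider a \textsc{MotifCC} instance on node set $V$ whose weights satisfy probability constraints, i.e. $w^+_{\mathcal{E}}+w^-_{\mathcal{E}}=1$ for every $\mathcal{E}\in E_k$. Run the Generalized CGW algorithm with $\gamma=1/(2(k-1))$ and $\delta=1/2$, with arbitrary choices of the nodes $u$. The clustering it outputs has \textsc{MotifCC} cost at most $4(k-1)$ times the optimal \textsc{MotifCC} cost.
   Context: \textsc{MotifCC}: $V$ is a set of $n$ nodes and $E_k$ is the set of all $k$-element subsets ("$k$-tuples", "hyperedges") of $V$. Each $\mathcal{E}\in E_k$ has weights $w^+_{\mathcal{E}},w^-_{\mathcal{E}}\ge 0$. A clustering (a partition of $V$) pays $w^+_{\mathcal{E}}$ for each $\mathcal{E}$ whose nodes are not all in one cluster, and $w^-_{\mathcal{E}}$ for each $\mathcal{E}$ whose nodes all lie in one cluster; the total is its cost. LP relaxation: variables $x_{uv}$ for unordered pairs of distinct nodes, and $x_{\mathcal{E}}$ for $\mathcal{E}\in E_k$. It minimizes $\sum_{\mathcal{E}\in E_k} w^+_{\mathcal{E}}x_{\mathcal{E}}+w^-_{\mathcal{E}}(1-x_{\mathcal{E}})$ subject to the following constraints: $x_{uv}\le x_{uw}+x_{vw}$ for all distinct $u,v,w$; $0\le x_{uv}\le 1$; $x_{uv}\le x_{\mathcal{E}}$ for all distinct $u,v\in\mathcal{E}$; $(k-1)x_{\mathcal{E}}\le\sum_{\{u,v\}\subseteq\mathcal{E}}x_{uv}$; and $0\le x_{\mathcal{E}}\le 1$.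 By convention $x_{uu}=0$. Generalized CGW algorithm with parameters $\gamma,\delta$: solve the LP relaxation to obtain $(x_{ij})$. Set $W=V$. While $W\ne\emptyset$: choose $u\in W$ arbitrarily and let $T_u=\{i\in W\setminus\{u\}: x_{ui}\le\gamma\}$. If $\sum_{i\in T_u}x_{ui}<\gamma\delta|T_u|$, let $S=\{u\}\cup T_u$; otherwise let $S=\{u\}$. Output $S$ as a cluster and set $W\leftarrow W\setminus S$. *)

theory Defs
  imports Complex_Main "HOL-Library.Ramsey" "HOL-Library.Disjoint_Sets"
begin

text \<open>The hyperedge set \<open>E\<^sub>k\<close> is \<open>nsets V k\<close>; unordered pairs of distinct nodes are \<open>nsets V 2\<close>.\<close>

definition motifcc_instance ::
  "'a set \<Rightarrow> nat \<Rightarrow> ('a set \<Rightarrow> real) \<Rightarrow> ('a set \<Rightarrow> real) \<Rightarrow> bool" where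
  "motifcc_instance V k wp wm \<longleftrightarrow>
     finite V \<and> (\<forall>E \<in> nsets V k. 0 \<le> wp E \<and> 0 \<le> wm E)"

definition motifcc_cost ::
  "'a set \<Rightarrow> nat \<Rightarrow> ('a set \<Rightarrow> real) \<Rightarrow> ('a set \<Rightarrow> real) \<Rightarrow> 'a set set \<Rightarrow> real" where
  "motifcc_cost V k wp wm P =
     (\<Sum>E \<in> nsets V k. if \<exists>C \<in> P. E \<subseteq> C then wm E else wp E)"

text \<open>For finite \<open>V\<close> the minimum ranges over a finite nonempty set, so it is a genuine minimum.\<close>

definition motifcc_opt ::
  "'a set \<Rightarrow> nat \<Rightarrow> ('a set \<Rightarrow> real) \<Rightarrow> ('a set \<Rightarrow> real) \<Rightarrow> real" where
  "motifcc_opt V k wp wm = Min (motifcc_cost V k wp wm ` {P. partition_on V P})"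

text \<open>The pair variables \<open>x\<^sub>u\<^sub>v\<close> are \<open>x {u, v}\<close> and the hyperedge variables are \<open>y E\<close>.  They are
  kept apart because for \<open>k = 2\<close> both families are indexed by the two-element sets.\<close>

definition lp_feasible ::
  "'a set \<Rightarrow> nat \<Rightarrow> ('a set \<Rightarrow> real) \<Rightarrow> ('a set \<Rightarrow> real) \<Rightarrow> bool" where
  "lp_feasible V k x y \<longleftrightarrow>
     (\<forall>u\<in>V. \<forall>v\<in>V. \<forall>w\<in>V. u \<noteq> v \<longrightarrow> u \<noteq> w \<longrightarrow> v \<noteq> w \<longrightarrow> x {u, v} \<le> x {u, w} + x {v, w}) \<and>
     (\<forall>p \<in> nsets V 2. 0 \<le> x p \<and> x p \<le> 1) \<and>
     (\<forall>E \<in> nsets V k. \<forall>u\<in>E. \<forall>v\<in>E. u \<noteq> v \<longrightarrow> x {u, v} \<le> y E) \<and>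
     (\<forall>E \<in> nsets V k. (real k - 1) * y E \<le> (\<Sum>p \<in> nsets E 2. x p)) \<and>
     (\<forall>E \<in> nsets V k. 0 \<le> y E \<and> y E \<le> 1)"

definition lp_objective ::
  "'a set \<Rightarrow> nat \<Rightarrow> ('a set \<Rightarrow> real) \<Rightarrow> ('a set \<Rightarrow> real) \<Rightarrow> ('a set \<Rightarrow> real) \<Rightarrow> real" where
  "lp_objective V k wp wm y = (\<Sum>E \<in> nsets V k. wp E * y E + wm E * (1 - y E))"

definition lp_optimal ::
  "'a set \<Rightarrow> nat \<Rightarrow> ('a set \<Rightarrow> real) \<Rightarrow> ('a set \<Rightarrow> real) \<Rightarrow>
   ('a set \<Rightarrow> real) \<Rightarrow> ('a set \<Rightarrow> real) \<Rightarrow> bool" where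
  "lp_optimal V k wp wm x y \<longleftrightarrow>
     is_arg_min (\<lambda>(x, y). lp_objective V k wp wm y) (\<lambda>(x, y). lp_feasible V k x y) (x, y)"

definition cgw_ball :: "real \<Rightarrow> ('a set \<Rightarrow> real) \<Rightarrow> 'a set \<Rightarrow> 'a \<Rightarrow> 'a set" where
  "cgw_ball \<gamma> x W u = {i \<in> W - {u}. x {u, i} \<le> \<gamma>}"

definition cgw_cluster :: "real \<Rightarrow> real \<Rightarrow> ('a set \<Rightarrow> real) \<Rightarrow> 'a set \<Rightarrow> 'a \<Rightarrow> 'a set" where
  "cgw_cluster \<gamma> \<delta> x W u =
     (let T = cgw_ball \<gamma> x W u in
      if (\<Sum>i\<in>T. x {u, i}) < \<gamma> * \<delta> * real (card T) then {u} \<union> T else {u})"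

text \<open>\<open>cgw_loop \<gamma> \<delta> x W P\<close>: the while loop, started with \<open>W\<close> as the set of remaining nodes, can
  output the collection of clusters \<open>P\<close> for some choice of the pivots \<open>u\<close>.\<close>

inductive cgw_loop :: "real \<Rightarrow> real \<Rightarrow> ('a set \<Rightarrow> real) \<Rightarrow> 'a set \<Rightarrow> 'a set set \<Rightarrow> bool"
  for \<gamma> \<delta> :: real and x :: "'a set \<Rightarrow> real" where
  finished: "cgw_loop \<gamma> \<delta> x {} {}"
| pivot: "u \<in> W \<Longrightarrow> S = cgw_cluster \<gamma> \<delta> x W u \<Longrightarrow> cgw_loop \<gamma> \<delta> x (W - S) P \<Longrightarrow>
          cgw_loop \<gamma> \<delta> x W (insert S P)"

text \<open>The possible outputs of the whole algorithm, over all optimal LP solutions and all pivot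
  choices.\<close>

definition cgw_output ::
  "'a set \<Rightarrow> nat \<Rightarrow> ('a set \<Rightarrow> real) \<Rightarrow> ('a set \<Rightarrow> real) \<Rightarrow> real \<Rightarrow> real \<Rightarrow> 'a set set \<Rightarrow> bool" where
  "cgw_output V k wp wm \<gamma> \<delta> P \<longleftrightarrow>
     (\<exists>x y. lp_optimal V k wp wm x y \<and> cgw_loop \<gamma> \<delta> x V P)"

lemma cgw_cluster_subset: "u \<in> W \<Longrightarrow> u \<in> cgw_cluster \<gamma> \<delta> x W u \<and> cgw_cluster \<gamma> \<delta> x W u \<subseteq> W"
  by (auto simp: cgw_cluster_def cgw_ball_def Let_def)

lemma cgw_loop_partition_on: "cgw_loop \<gamma> \<delta> x W P \<Longrightarrow> partition_on W P"
proof (induction rule: cgw_loop.induct)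
  case finished
  show ?case by (simp add: partition_on_def disjoint_def)
next
  case (pivot u W S P)
  have "u \<in> S" "S \<subseteq> W"
    using cgw_cluster_subset[OF pivot.hyps(1)] pivot.hyps(2) by auto
  then show ?case
    using pivot.IH unfolding partition_on_def disjoint_def by (auto; blast)
qed

lemma cgw_loop_exists: "finite W \<Longrightarrow> \<exists>P. cgw_loop \<gamma> \<delta> x W P"
proof (induction W rule: finite_psubset_induct)
  case (psubset W)
  show ?case
  proof (cases "W = {}")
    case True
    then show ?thesis using cgw_loop.finished by blast
  next
    case False
    then obtain u where u: "u \<in> W" by blast
    have "W - cgw_cluster \<gamma> \<delta> x W u \<subset> W"
      using cgw_cluster_subset[OF u] u by blast
    then obtain P where "cgw_loop \<gamma> \<delta> x (W - cgw_cluster \<gamma> \<delta> x W u) P"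
      using psubset.IH by blast
    then show ?thesis using cgw_loop.pivot[OF u refl] by blast
  qed
qed

end

theory Submission
  imports Defs
begin

text \<open>
  The clusters are charged one pivot at a time: with \<open>\<gamma> = 1/(2(k-1))\<close>, the hyperedges that a
  new cluster \<open>S\<close> meets have LP cost at least \<open>\<gamma>/2\<close> times what the clustering pays for them,
  and \<open>2/\<gamma> = 4(k-1)\<close>.  Summing the triangle inequality through the pivot \<open>u\<close> over the pairs of
  \<open>E\<close> gives \<open>x\<^sub>E \<le> \<Sum>i\<in>E. x\<^sub>u\<^sub>i\<close>, while \<open>x\<^sub>E \<ge> x\<^sub>u\<^sub>i - x\<^sub>u\<^sub>j\<close> for
  \<open>i, j \<in> E\<close>.

  Most hyperedges satisfy the bound individually.  The others are averaged over the subsets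
  \<open>A\<close> of the ball \<open>T\<^sub>u\<close> of a fixed size, because \<open>\<Sum>i\<in>A. x\<^sub>u\<^sub>i - \<gamma>/2\<close>, summed over all
  these \<open>A\<close>, has the sign of \<open>\<Sum>i\<in>T\<^sub>u. x\<^sub>u\<^sub>i - \<gamma>/2\<close>, which is what the algorithm tests.  If
  \<open>S = {u}\<close> this is applied to \<open>E = A \<union> {u}\<close>; if \<open>S = {u} \<union> T\<^sub>u\<close> it is applied to
  \<open>E = A \<union> B\<close> for each fixed part \<open>B\<close> outside \<open>S\<close>.
\<close>

section \<open>Double counting over subsets of a fixed size\<close>

lemma nsets_containing_eq_image:
  assumes "i \<in> T" "a > 0"
  shows "{A \<in> nsets T a. i \<in> A} = insert i ` nsets (T - {i}) (a - 1)"
proof (intro set_eqI iffI)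
  fix A assume "A \<in> {A \<in> nsets T a. i \<in> A}"
  then have "A - {i} \<in> nsets (T - {i}) (a - 1)" "A = insert i (A - {i})"
    by (auto simp: nsets_def)
  then show "A \<in> insert i ` nsets (T - {i}) (a - 1)" by blast
next
  fix A assume "A \<in> insert i ` nsets (T - {i}) (a - 1)"
  then obtain B where B: "B \<in> nsets (T - {i}) (a - 1)" "A = insert i B" by blast
  then have "finite B" "i \<notin> B" "card B = a - 1" "B \<subseteq> T" by (auto simp: nsets_def)
  then show "A \<in> {A \<in> nsets T a. i \<in> A}"
    using B assms by (auto simp: nsets_def)
qed

lemma card_nsets_containing:
  assumes "finite T" "i \<in> T" "a > 0"
  shows "card {A \<in> nsets T a. i \<in> A} = (card T - 1) choose (a - 1)"
proof -
  have "inj_on (insert i) (nsets (T - {i}) (a - 1))"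
    by (auto simp: inj_on_def nsets_def insert_ident)
  then show ?thesis
    using assms by (simp add: nsets_containing_eq_image card_image card_nsets)
qed

text \<open>Each point of \<open>T\<close> lies in equally many \<open>a\<close>-subsets. Besides
  the averaging, the case \<open>a = 2\<close> turns sums over the pairs of a hyperedge into sums
  over its nodes.\<close>

lemma sum_nsets_sum:
  fixes f :: "'a \<Rightarrow> real"
  assumes "finite T" "a > 0"
  shows "(\<Sum>A\<in>nsets T a. \<Sum>i\<in>A. f i) = real ((card T - 1) choose (a - 1)) * (\<Sum>i\<in>T. f i)"
proof -
  have "(\<Sum>A\<in>nsets T a. \<Sum>i\<in>A. f i) = (\<Sum>A\<in>nsets T a. \<Sum>i | i \<in> T \<and> i \<in> A. f i)"
    by (intro sum.cong) (auto simp: nsets_def)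
  also have "\<dots> = (\<Sum>i\<in>T. \<Sum>A | A \<in> nsets T a \<and> i \<in> A. f i)"
    using assms by (intro sum.swap_restrict) (auto simp: finite_imp_finite_nsets)
  also have "\<dots> = (\<Sum>i\<in>T. real ((card T - 1) choose (a - 1)) * f i)"
    using assms by (intro sum.cong) (auto simp: card_nsets_containing)
  finally show ?thesis by (simp add: sum_distrib_left)
qed

lemma sum_nsets_sum_nonneg:
  fixes f :: "'a \<Rightarrow> real"
  assumes "finite T" "a > 0" "(\<Sum>i\<in>T. f i) \<ge> 0"
  shows "(\<Sum>A\<in>nsets T a. \<Sum>i\<in>A. f i) \<ge> 0"
  using assms by (simp add: sum_nsets_sum)

text \<open>Removing a point of maximal \<open>d\<close> keeps the average of \<open>d\<close> below \<open>1/4\<close>, and the pairs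
  removed with it have a nonnegative sum.\<close>

lemma sum_pairs_nonneg:
  fixes d :: "'a \<Rightarrow> real" and h :: "'a set \<Rightarrow> real"
  assumes "finite T" and "(\<Sum>i\<in>T. d i) \<le> real (card T) / 4"
    and "\<And>i j. i \<in> T \<Longrightarrow> j \<in> T \<Longrightarrow> i \<noteq> j \<Longrightarrow> d j \<le> d i \<Longrightarrow> d i \<le> 3/8 \<Longrightarrow> 0 \<le> h {i, j}"
    and "\<And>i j. i \<in> T \<Longrightarrow> j \<in> T \<Longrightarrow> i \<noteq> j \<Longrightarrow> d j \<le> d i \<Longrightarrow> 3/8 < d i \<Longrightarrow> 1/4 - d j \<le> h {i, j}"
  shows "0 \<le> (\<Sum>p\<in>nsets T 2. h p)"
  using assms
proof (induction T rule: finite_psubset_induct)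
  case (psubset T)
  show ?case
  proof (cases "T = {}")
    case True
    then show ?thesis by (simp add: nsets_empty_iff)
  next
    case False
    have "Max (d ` T) \<in> d ` T" using psubset.hyps(1) False by simp
    then obtain m where m_max: "m \<in> T" "d m = Max (d ` T)" by force
    have m: "m \<in> T" "\<And>i. i \<in> T \<Longrightarrow> d i \<le> d m"
      using m_max psubset.hyps(1) by auto
    let ?R = "T - {m}"
    have fR: "finite ?R" using psubset.hyps by simp
    have card: "real (card T) = real (card ?R) + 1"
      using card.remove[OF psubset.hyps(1) m(1)] by simp
    have sumd: "(\<Sum>i\<in>T. d i) = d m + (\<Sum>i\<in>?R. d i)"
      using sum.remove[OF psubset.hyps(1) m(1)] by simp
    have avg: "(\<Sum>i\<in>?R. d i) \<le> real (card ?R) / 4"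
    \<comment> \<open>If the maximum is at most \<open>1/4\<close>, so is every value; otherwise the
      sum loses more than \<open>1/4\<close> while the allowance drops by exactly
      \<open>1/4\<close>.\<close>
    proof (cases "d m \<le> 1/4")
      case True
      have "(\<Sum>i\<in>?R. d i) \<le> (\<Sum>i\<in>?R. 1/4)"
        using m(2) True by (intro sum_mono) (meson DiffD1 order_trans)
      then show ?thesis by simp
    next
      case False
      then show ?thesis using psubset.prems(1) card sumd by (simp add: field_simps)
    qed
    have split: "nsets T 2 = nsets ?R 2 \<union> (\<lambda>i. {m, i}) ` ?R"
    proof -
      have "p \<in> nsets T 2 \<longleftrightarrow> p \<in> nsets ?R 2 \<union> (\<lambda>i. {m, i}) ` ?R" for p
      proof (cases "m \<in> p")
        case True
        then have "p \<in> nsets T 2 \<longleftrightarrow> p \<in> {A \<in> nsets T 2. m \<in> A}" by simp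
        also have "\<dots> \<longleftrightarrow> p \<in> (\<lambda>i. {m, i}) ` ?R"
          using nsets_containing_eq_image[OF m(1), of 2] by (simp add: nsets_one image_image)
        finally show ?thesis using True by (auto simp: nsets_def)
      qed (auto simp: nsets_def)
      then show ?thesis by blast
    qed
    have "(\<Sum>p\<in>nsets T 2. h p) = (\<Sum>p\<in>nsets ?R 2. h p) + (\<Sum>p\<in>(\<lambda>i. {m, i}) ` ?R. h p)"
      unfolding split using fR
      by (intro sum.union_disjoint) (auto simp: finite_imp_finite_nsets nsets_def)
    also have "(\<Sum>p\<in>(\<lambda>i. {m, i}) ` ?R. h p) = (\<Sum>i\<in>?R. h {m, i})"
      by (subst sum.reindex) (auto simp: inj_on_def doubleton_eq_iff)
    finally have eq: "(\<Sum>p\<in>nsets T 2. h p) = (\<Sum>p\<in>nsets ?R 2. h p) + (\<Sum>i\<in>?R. h {m, i})" .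
    have "0 \<le> (\<Sum>p\<in>nsets ?R 2. h p)"
      using m(1) avg psubset.prems(2,3) by (intro psubset.IH) auto
    moreover have "0 \<le> (\<Sum>i\<in>?R. h {m, i})"
    proof (cases "d m \<le> 3/8")
      case True
      then show ?thesis using m psubset.prems(2) by (intro sum_nonneg) auto
    next
      case False
      have "0 \<le> (\<Sum>i\<in>?R. 1/4 - d i)" using avg by (simp add: sum_subtractf)
      also have "\<dots> \<le> (\<Sum>i\<in>?R. h {m, i})"
        using m psubset.prems(3) False by (intro sum_mono) auto
      finally show ?thesis .
    qed
    ultimately show ?thesis using eq by simp
  qed
qed

section \<open>Charging a single pivot\<close>

text \<open>One iteration of the loop with pivot \<open>u\<close>, where \<open>d i\<close> stands for \<open>x\<^sub>u\<^sub>i\<close> (with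
  \<open>x\<^sub>u\<^sub>u = 0\<close>).  The analysis needs the LP constraints only through \<open>y_upper\<close> and
  \<open>y_lower\<close>.\<close>

locale pivot_step =
  fixes W :: "'a set" and k :: nat and u :: 'a and d :: "'a \<Rightarrow> real"
    and wp wm y :: "'a set \<Rightarrow> real" and \<gamma> :: real
  assumes fin: "finite W" and u: "u \<in> W" and k: "k \<ge> 2" and \<gamma>: "(real k - 1) * \<gamma> = 1/2"
    and d_u: "d u = 0" and d_nonneg: "\<And>i. i \<in> W \<Longrightarrow> 0 \<le> d i"
    and wp: "\<And>E. E \<in> nsets W k \<Longrightarrow> 0 \<le> wp E" and wm: "\<And>E. E \<in> nsets W k \<Longrightarrow> 0 \<le> wm E"
    and prob: "\<And>E. E \<in> nsets W k \<Longrightarrow> wp E + wm E = 1"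
    and y_nonneg: "\<And>E. E \<in> nsets W k \<Longrightarrow> 0 \<le> y E"
    and y_le_1: "\<And>E. E \<in> nsets W k \<Longrightarrow> y E \<le> 1"
    and y_upper: "\<And>E. E \<in> nsets W k \<Longrightarrow> y E \<le> (\<Sum>i\<in>E. d i)"
    and y_lower: "\<And>E i j. E \<in> nsets W k \<Longrightarrow> i \<in> E \<Longrightarrow> j \<in> E \<Longrightarrow> d i - d j \<le> y E"
begin

definition lp :: "'a set \<Rightarrow> real" where
  "lp E = wp E * y E + wm E * (1 - y E)"

definition T :: "'a set" where
  "T = {i \<in> W - {u}. d i \<le> \<gamma>}"

lemma T_subset: "T \<subseteq> W" and u_notin_T: "u \<notin> T" and finite_T: "finite T"
  using fin by (auto simp: T_def)

lemma \<gamma>_pos: "0 < \<gamma>" and \<gamma>_le: "\<gamma> \<le> 1/2"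
proof -
  have "real k - 1 \<ge> 1" using k by simp
  then show p: "0 < \<gamma>" using \<gamma> zero_less_mult_iff[of "real k - 1" \<gamma>] by simp
  then have "1 * \<gamma> \<le> (real k - 1) * \<gamma>" using \<open>real k - 1 \<ge> 1\<close> by (intro mult_right_mono) auto
  then show "\<gamma> \<le> 1/2" using \<gamma> by simp
qed

lemma nsetsD: "E \<in> nsets W k \<Longrightarrow> E \<subseteq> W \<and> finite E \<and> card E = k"
  by (simp add: nsets_def)

lemma lp_nonneg_split: "E \<in> nsets W k \<Longrightarrow> 0 \<le> wp E * y E \<and> 0 \<le> wm E * (1 - y E)"
  using wp wm y_nonneg y_le_1 by simp

lemma lp_ge_wp:
  assumes "E \<in> nsets W k" "\<gamma> / 2 \<le> y E"
  shows "\<gamma> / 2 * wp E \<le> lp E"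
  using mult_left_mono[OF assms(2) wp[OF assms(1)]] lp_nonneg_split[OF assms(1)]
  by (simp add: lp_def mult.commute)

lemma lp_ge_wm:
  assumes "E \<in> nsets W k" "y E \<le> 1 - \<gamma> / 2"
  shows "\<gamma> / 2 * wm E \<le> lp E"
proof -
  have "\<gamma> / 2 \<le> 1 - y E" using assms(2) by simp
  from mult_left_mono[OF this wm[OF assms(1)]] lp_nonneg_split[OF assms(1)]
  show ?thesis by (simp add: lp_def mult.commute)
qed

text \<open>By the probability constraint \<open>lp E\<close> is a convex combination of
  \<open>y E\<close> and \<open>1 - y E\<close>, so it inherits any common lower bound.\<close>

lemma lp_ge_common_bound:
  assumes "E \<in> nsets W k" "l \<le> y E" "l \<le> 1 - y E"
  shows "l \<le> lp E"
proof -
  have "wp E * l + wm E * l \<le> lp E"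
    unfolding lp_def using assms wp wm by (intro add_mono mult_left_mono) auto
  moreover have "wp E * l + wm E * l = l"
    using prob[OF assms(1)] by (metis distrib_right mult_1)
  ultimately show ?thesis by simp
qed

lemma y_ge_if_pivot_and_far:
  assumes "E \<in> nsets W k" "u \<in> E" "\<not> E \<subseteq> insert u T"
  shows "\<gamma> / 2 \<le> y E"
proof -
  obtain z where z: "z \<in> E" "z \<notin> insert u T" using assms(3) by blast
  then have "\<gamma> < d z" using nsetsD[OF assms(1)] by (auto simp: T_def)
  then show ?thesis
    using y_lower[OF assms(1) z(1) assms(2)] d_u \<gamma>_pos by simp
qed

text \<open>The pivot contributes zero to the upper bound on \<open>y E\<close>. The other
  \<open>k - 1\<close> nodes contribute at most \<open>\<gamma>\<close> each, and the value of
  \<open>\<gamma>\<close> makes this total \<open>1/2\<close>.\<close>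

lemma y_le_half_if_pivot_and_near:
  assumes "E \<in> nsets W k" "u \<in> E" "E \<subseteq> insert u T"
  shows "y E \<le> 1/2"
proof -
  have E: "finite E" "card E = k" using nsetsD[OF assms(1)] by auto
  have "(\<Sum>i\<in>E. d i) = (\<Sum>i\<in>E - {u}. d i)"
    using sum.remove[OF E(1) assms(2), of d] d_u by simp
  also have "\<dots> \<le> (\<Sum>i\<in>E - {u}. \<gamma>)"
    using assms(3) by (intro sum_mono) (auto simp: T_def)
  also have "\<dots> = 1/2"
    using E assms(2) k \<gamma> by (simp add: of_nat_diff)
  finally show ?thesis using y_upper[OF assms(1)] by simp
qed

section \<open>The pivot as a cluster of its own\<close>

text \<open>Every hyperedge through \<open>u\<close> is cut here, hence the weight
  \<open>wp\<close>. Those that leave \<open>insert u T\<close> pay individually. For the others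
  \<open>y E \<le> 1/2\<close>, so \<open>lp E\<close> is at least \<open>y E\<close>, which in turn
  is at least every \<open>d i\<close> on \<open>E\<close>.\<close>

lemma singleton_cluster:
  assumes "\<gamma> / 2 * real (card T) \<le> (\<Sum>i\<in>T. d i)"
  shows "0 \<le> (\<Sum>E | E \<in> nsets W k \<and> u \<in> E. lp E - \<gamma> / 2 * wp E)"
proof -
  let ?X = "{E \<in> nsets W k. u \<in> E}"
  let ?N = "insert u ` nsets T (k - 1)"
  let ?h = "\<lambda>E. lp E - \<gamma> / 2 * wp E"
  have finX: "finite ?X" using fin by (simp add: finite_imp_finite_nsets)
  have N: "?N \<subseteq> ?X"
    using nsets_containing_eq_image[of u W k] u k u_notin_T T_subset
      nsets_mono[of T "W - {u}" "k - 1"] by auto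
  have far: "0 \<le> ?h E" if "E \<in> ?X - ?N" for E
  proof -
    have "\<not> E \<subseteq> insert u T"
    proof
      assume "E \<subseteq> insert u T"
      then have "E \<in> {A \<in> nsets (insert u T) k. u \<in> A}"
        using that by (auto simp: nsets_def)
      then show False
        using that nsets_containing_eq_image[of u "insert u T" k] k u_notin_T by auto
    qed
    then show ?thesis
      using that y_ge_if_pivot_and_far lp_ge_wp by fastforce
  qed
  have near: "(\<Sum>i\<in>A. d i - \<gamma> / 2) \<le> (real k - 1) * ?h (insert u A)"
    if A: "A \<in> nsets T (k - 1)" for A
  proof -
    let ?E = "insert u A"
    have E: "?E \<in> nsets W k" "u \<in> ?E" "?E \<subseteq> insert u T" using A N by (auto simp: nsets_def)
    have cA: "real (card A) = real k - 1" using A k by (simp add: nsets_def of_nat_diff)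
    have "y ?E \<le> lp ?E"
      using y_le_half_if_pivot_and_near[OF E] by (intro lp_ge_common_bound[OF E(1)]) auto
    moreover have "\<gamma> / 2 * wp ?E \<le> \<gamma> / 2"
      using prob[OF E(1)] wm[OF E(1)] \<gamma>_pos by (simp add: mult_left_le)
    ultimately have "y ?E - \<gamma> / 2 \<le> ?h ?E" by simp
    then have "(real k - 1) * (y ?E - \<gamma> / 2) \<le> (real k - 1) * ?h ?E"
      using k by (intro mult_left_mono) auto
    \<comment> \<open>Since \<open>d u = 0\<close>, each of the \<open>k - 1\<close> members of
      \<open>A\<close> gives \<open>d i \<le> y ?E\<close>; adding these up produces the factor
      \<open>k - 1\<close>.\<close>
    moreover have "(\<Sum>i\<in>A. d i - \<gamma> / 2) \<le> (\<Sum>i\<in>A. y ?E - \<gamma> / 2)"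
      using y_lower[OF E(1) _ E(2)] d_u by (intro sum_mono) auto
    ultimately show ?thesis using cA by simp
  qed
  have "0 \<le> (\<Sum>A\<in>nsets T (k - 1). \<Sum>i\<in>A. d i - \<gamma> / 2)"
    using assms finite_T k
    by (intro sum_nsets_sum_nonneg) (auto simp: sum_subtractf algebra_simps)
  also have "\<dots> \<le> (\<Sum>A\<in>nsets T (k - 1). (real k - 1) * ?h (insert u A))"
    using near by (intro sum_mono)
  also have "\<dots> = (real k - 1) * (\<Sum>A\<in>nsets T (k - 1). ?h (insert u A))"
    by (simp add: sum_distrib_left)
  also have "(\<Sum>A\<in>nsets T (k - 1). ?h (insert u A)) = sum ?h ?N"
  proof (subst sum.reindex)
    show "inj_on (insert u) (nsets T (k - 1))"
      using u_notin_T by (intro inj_onI) (metis (no_types, lifting) insert_ident mem_Collect_eq nsets_def subsetD)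
  qed simp
  finally have "0 \<le> sum ?h ?N" using k by (simp add: zero_le_mult_iff)
  moreover have "0 \<le> sum ?h (?X - ?N)" using far by (rule sum_nonneg)
  ultimately show ?thesis using sum.subset_diff[OF N finX, of ?h] by simp
qed

section \<open>The pivot clustered with its ball\<close>

text \<open>For \<open>k \<ge> 3\<close> every edge inside the ball pays for itself; only \<open>k = 2\<close> needs averaging.\<close>

lemma near_edges:
  assumes "(\<Sum>i\<in>T. d i) \<le> \<gamma> / 2 * real (card T)"
  shows "0 \<le> (\<Sum>E\<in>nsets T k. lp E - \<gamma> / 2 * wm E)"
proof (cases "k = 2")
  case False
  have "\<gamma> / 2 * wm E \<le> lp E" if E: "E \<in> nsets T k" for E
  proof -
    have EW: "E \<in> nsets W k" using E nsets_mono[OF T_subset] by blast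
    have "(\<Sum>i\<in>E. d i) \<le> (\<Sum>i\<in>E. \<gamma>)"
      using E by (intro sum_mono) (auto simp: T_def nsets_def)
    also have "\<dots> = 1/2 + \<gamma>" using \<gamma> E by (simp add: nsets_def algebra_simps)
    finally have "y E \<le> 1/2 + \<gamma>" using y_upper[OF EW] by simp
    \<comment> \<open>For \<open>k \<ge> 3\<close> this means \<open>\<gamma> \<le> 1/4\<close>,
      while \<open>1/2 + \<gamma> \<le> 1 - \<gamma> / 2\<close> asks only for
      \<open>\<gamma> \<le> 1/3\<close>.\<close>
    moreover have "2 * \<gamma> \<le> (real k - 1) * \<gamma>"
      using False k \<gamma>_pos by (intro mult_right_mono) auto
    ultimately show ?thesis using \<gamma> \<gamma>_pos by (intro lp_ge_wm[OF EW]) linarith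
  qed
  then show ?thesis by (intro sum_nonneg) simp
next
  case True
  have \<gamma>2: "\<gamma> = 1/2" using \<gamma> True by simp
  have pair: "{i, j} \<in> nsets W k" if "i \<in> T" "j \<in> T" "i \<noteq> j" for i j
    using that T_subset True by auto
  have up: "y {i, j} \<le> d i + d j" if "i \<in> T" "j \<in> T" "i \<noteq> j" for i j
    using y_upper[OF pair[OF that]] that by simp
  have "0 \<le> (\<Sum>E\<in>nsets T 2. lp E - \<gamma> / 2 * wm E)"
  proof (rule sum_pairs_nonneg[OF finite_T, where d = d])
    show "(\<Sum>i\<in>T. d i) \<le> real (card T) / 4"
    proof -
      have "\<gamma> / 2 = 1/4" using \<gamma>2 by simp
      then show ?thesis using assms by (metis mult.commute mult_1_right times_divide_eq_right)
    qed
  next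
    \<comment> \<open>The threshold \<open>3/8\<close> is half of
      \<open>1 - \<gamma> / 2 = 3/4\<close>, so two such nodes keep \<open>y\<close> low enough for
      the pair to pay for itself.\<close>
    fix i j assume ij: "i \<in> T" "j \<in> T" "i \<noteq> j" "d j \<le> d i" "d i \<le> 3/8"
    then have "y {i, j} \<le> 1 - \<gamma> / 2" using up[OF ij(1-3)] \<gamma>2 by linarith
    then show "0 \<le> lp {i, j} - \<gamma> / 2 * wm {i, j}"
      using lp_ge_wm[OF pair[OF ij(1-3)]] by simp
  next
    fix i j assume ij: "i \<in> T" "j \<in> T" "i \<noteq> j" "d j \<le> d i" "3/8 < d i"
    let ?E = "{i, j}"
    note E = pair[OF ij(1-3)]
    have "d i \<le> 1/2" using ij(1) \<gamma>_le unfolding T_def by auto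
    \<comment> \<open>For \<open>wp\<close>, use \<open>y ?E \<ge> d i - d j\<close> and
      \<open>d i > 1/4\<close>; for \<open>wm\<close>, use \<open>y ?E \<le> d i + d j\<close> and
      \<open>d i \<le> 1/2\<close>.\<close>
    have "wp ?E * (1/4 - d j) + wm ?E * (1/4 - d j) \<le> wp ?E * y ?E + wm ?E * (1 - y ?E - 1/4)"
      using wp[OF E] wm[OF E] y_lower[OF E, of i j] up[OF ij(1-3)] ij \<open>d i \<le> 1/2\<close>
      by (intro add_mono mult_left_mono) auto
    moreover have "wp ?E * (1/4 - d j) + wm ?E * (1/4 - d j) = 1/4 - d j"
      using prob[OF E] by (metis distrib_right mult_1)
    ultimately show "1/4 - d j \<le> lp ?E - \<gamma> / 2 * wm ?E"
      unfolding lp_def \<gamma>2 by (simp add: algebra_simps)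
  qed
  then show ?thesis using True by simp
qed

text \<open>Let \<open>s\<close> be the average of \<open>d\<close> on \<open>A\<close>. A node of
  \<open>B\<close> gives \<open>y \<ge> \<gamma> - s\<close>, and the sum of \<open>d\<close> over
  the hyperedge gives \<open>y \<le> 3/4 + s\<close>. With weights adding up to 1, these leave a
  surplus of at least \<open>\<gamma> / 2 - s\<close>.\<close>

lemma crossing_edge_bound:
  assumes E: "A \<union> B \<in> nsets W k" and A: "A \<subseteq> T" "A \<noteq> {}"
    and B: "B \<inter> insert u T = {}" "B \<noteq> {}" "\<And>z. z \<in> B \<Longrightarrow> d z \<le> 3/2 * \<gamma>"
  shows "(\<Sum>i\<in>A. \<gamma> / 2 - d i) \<le> real (card A) * (lp (A \<union> B) - \<gamma> / 2 * wp (A \<union> B))"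
proof -
  let ?E = "A \<union> B"
  define a where "a = real (card A)"
  define s where "s = (\<Sum>i\<in>A. d i) / a"
  have fin': "finite A" "finite B" "B \<subseteq> W" using nsetsD[OF E] by auto
  have disj: "A \<inter> B = {}" using A B by blast
  have ab: "card A + card B = k"
    using nsetsD[OF E] card_Un_disjoint[OF fin'(1,2) disj] by simp
  have a1: "a \<ge> 1" using A(2) fin' by (simp add: a_def Suc_le_eq card_gt_0_iff)
  have sA: "(\<Sum>i\<in>A. d i) = a * s" using a1 by (simp add: s_def)
  obtain z where z: "z \<in> B" using B(2) by blast
  then have dz: "\<gamma> < d z" using B(1) fin'(3) by (auto simp: T_def)
  have "(\<Sum>i\<in>A. \<gamma> - d i) \<le> (\<Sum>i\<in>A. y ?E)"
    using y_lower[OF E, of z] z dz by (intro sum_mono) force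
  then have "a * (\<gamma> - s) \<le> a * y ?E"
    using sA by (simp add: sum_subtractf a_def algebra_simps)
  then have lower: "\<gamma> - s \<le> y ?E" using a1 by simp
  have "a * s \<le> (\<Sum>i\<in>A. \<gamma>)"
    unfolding sA[symmetric] using A(1) by (intro sum_mono) (auto simp: T_def)
  then have "a * s \<le> a * \<gamma>" by (simp add: a_def)
  then have s: "s \<le> \<gamma>" using a1 by simp
  have "(\<Sum>i\<in>?E. d i) = (\<Sum>i\<in>B. d i) + a * s"
    using fin' disj sA by (simp add: sum.union_disjoint)
  also have "(\<Sum>i\<in>B. d i) \<le> (\<Sum>i\<in>B. 3/2 * \<gamma>)" using B(3) by (intro sum_mono)
  also have "\<dots> = real (card B) * (3/2 * \<gamma>)" by simp
  finally have "y ?E \<le> real (card B) * (3/2 * \<gamma>) + (a - 1) * s + s"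
    using y_upper[OF E] by (simp add: algebra_simps)
  \<comment> \<open>One copy of \<open>s\<close> is set aside; the remaining \<open>k - 1\<close>
    nodes are allotted \<open>3/2 * \<gamma>\<close> each, which totals \<open>3/4\<close>.\<close>
  moreover have "(a - 1) * s \<le> (a - 1) * (3/2 * \<gamma>)"
    using a1 s \<gamma>_pos by (intro mult_left_mono) auto
  moreover have "real (card B) * (3/2 * \<gamma>) + (a - 1) * (3/2 * \<gamma>) = 3/2 * ((real k - 1) * \<gamma>)"
  proof -
    have "real k = a + real (card B)" using ab by (simp add: a_def)
    then show ?thesis by (simp add: field_simps)
  qed
  ultimately have upper: "y ?E \<le> 3/4 + s" using \<gamma> by linarith
  \<comment> \<open>The \<open>wm\<close> part uses \<open>1 - y \<ge> 1/4 - s\<close> together with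
    \<open>\<gamma> / 2 \<le> 1/4\<close>.\<close>
  have "wp ?E * (\<gamma> / 2 - s) + wm ?E * (\<gamma> / 2 - s) \<le> wp ?E * (y ?E - \<gamma> / 2) + wm ?E * (1 - y ?E)"
    using wp[OF E] wm[OF E] lower upper \<gamma>_le by (intro add_mono mult_left_mono) auto
  moreover have "wp ?E * (\<gamma> / 2 - s) + wm ?E * (\<gamma> / 2 - s) = \<gamma> / 2 - s"
    using prob[OF E] by (metis distrib_right mult_1)
  ultimately have "\<gamma> / 2 - s \<le> lp ?E - \<gamma> / 2 * wp ?E"
    unfolding lp_def by (simp add: algebra_simps)
  then have "a * (\<gamma> / 2 - s) \<le> a * (lp ?E - \<gamma> / 2 * wp ?E)"
    using a1 by (intro mult_left_mono) auto
  then show ?thesis using sA by (simp add: sum_subtractf a_def algebra_simps)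
qed

text \<open>A node of \<open>B\<close> beyond \<open>3/2 * \<gamma>\<close> differs in
  \<open>d\<close> by more than \<open>\<gamma> / 2\<close> from every node of \<open>T\<close>, so
  each hyperedge pays for itself. Otherwise \<open>crossing_edge_bound\<close> applies to every
  \<open>A\<close> and the average decides; \<open>card B < k\<close> keeps \<open>A\<close>
  nonempty.\<close>

lemma crossing_edges_with_outer_part:
  assumes avg: "(\<Sum>i\<in>T. d i) \<le> \<gamma> / 2 * real (card T)"
    and B: "B \<subseteq> W - insert u T" "B \<noteq> {}" "card B < k"
  shows "0 \<le> (\<Sum>A\<in>nsets T (k - card B). lp (A \<union> B) - \<gamma> / 2 * wp (A \<union> B))"
proof -
  let ?a = "k - card B"
  have finB: "finite B" using B(1) fin finite_subset by blast
  have E: "A \<union> B \<in> nsets W k" and A: "A \<subseteq> T" "A \<noteq> {}" "card A = ?a" if "A \<in> nsets T ?a" for A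
  proof -
    show "A \<subseteq> T" "card A = ?a" "A \<noteq> {}" using that B(3) by (auto simp: nsets_def)
    moreover have "finite A" "A \<inter> B = {}" using that B(1) by (auto simp: nsets_def)
    ultimately show "A \<union> B \<in> nsets W k"
      using B finB T_subset by (auto simp: nsets_def card_Un_disjoint)
  qed
  show ?thesis
  proof (cases "\<exists>z\<in>B. 3/2 * \<gamma> < d z")
    case True
    then obtain z where z: "z \<in> B" "3/2 * \<gamma> < d z" by blast
    have "\<gamma> / 2 * wp (A \<union> B) \<le> lp (A \<union> B)" if mem: "A \<in> nsets T ?a" for A
    proof -
      obtain i where i: "i \<in> A" "d i \<le> \<gamma>" using A(1,2)[OF mem] by (auto simp: T_def)
      then show ?thesis
        using y_lower[OF E[OF mem], of z i] z by (intro lp_ge_wp[OF E[OF mem]]) auto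
    qed
    then show ?thesis by (intro sum_nonneg) simp
  next
    case False
    have "0 \<le> (\<Sum>A\<in>nsets T ?a. \<Sum>i\<in>A. \<gamma> / 2 - d i)"
      using avg finite_T B(3)
      by (intro sum_nsets_sum_nonneg) (auto simp: sum_subtractf algebra_simps)
    also have "\<dots> \<le> (\<Sum>A\<in>nsets T ?a. real ?a * (lp (A \<union> B) - \<gamma> / 2 * wp (A \<union> B)))"
    proof (intro sum_mono)
      fix A assume mem: "A \<in> nsets T ?a"
      have "B \<inter> insert u T = {}" using B(1) by blast
      moreover have "d z \<le> 3/2 * \<gamma>" if "z \<in> B" for z using False that by force
      ultimately show "(\<Sum>i\<in>A. \<gamma> / 2 - d i) \<le> real ?a * (lp (A \<union> B) - \<gamma> / 2 * wp (A \<union> B))"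
        using crossing_edge_bound[OF E[OF mem] A(1,2)[OF mem] _ B(2)] A(3)[OF mem] by simp
    qed
    also have "\<dots> = real ?a * (\<Sum>A\<in>nsets T ?a. lp (A \<union> B) - \<gamma> / 2 * wp (A \<union> B))"
      by (simp add: sum_distrib_left)
    finally show ?thesis using B(3) by (simp add: zero_le_mult_iff)
  qed
qed

text \<open>The hyperedges are grouped by their part \<open>E - T\<close>. The group of
  \<open>B\<close> consists of all \<open>A \<union> B\<close> with \<open>A\<close> ranging over
  the subsets of \<open>T\<close> of size \<open>k - card B\<close>, which is the family already
  averaged.\<close>

lemma crossing_edges:
  assumes avg: "(\<Sum>i\<in>T. d i) \<le> \<gamma> / 2 * real (card T)"
  shows "0 \<le> (\<Sum>E | E \<in> nsets W k \<and> u \<notin> E \<and> E \<inter> T \<noteq> {} \<and> \<not> E \<subseteq> T. lp E - \<gamma> / 2 * wp E)"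
    (is "0 \<le> sum ?h ?X")
proof -
  have finX: "finite ?X" using fin by (simp add: finite_imp_finite_nsets)
  have "0 \<le> sum ?h {E. E \<in> ?X \<and> E - T = B}" if mem: "B \<in> (\<lambda>E. E - T) ` ?X" for B
  proof -
    obtain E where E: "E \<in> ?X" "B = E - T" using mem by blast
    have EW: "E \<subseteq> W" "finite E" "card E = k" using nsetsD E(1) by auto
    have B: "B \<subseteq> W - insert u T" "B \<noteq> {}" using E EW by auto
    have "B \<subset> E" using E by blast
    then have cB: "card B < k" using EW psubset_card_mono by blast
    have finB: "finite B" using E EW by blast
    have eq: "{E. E \<in> ?X \<and> E - T = B} = (\<lambda>A. A \<union> B) ` nsets T (k - card B)"
    proof (intro set_eqI iffI)
      fix F assume F: "F \<in> {E. E \<in> ?X \<and> E - T = B}"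
      then have FW: "finite F" "card F = k" using nsetsD by auto
      have "card (F \<inter> T) = k - card B"
        using F FW card_Diff_subset_Int[of F T] card_Int_Diff[of F T] by auto
      then have "F \<inter> T \<in> nsets T (k - card B)" using FW by (auto simp: nsets_def)
      moreover have "F = (F \<inter> T) \<union> B" using F by blast
      ultimately show "F \<in> (\<lambda>A. A \<union> B) ` nsets T (k - card B)" by blast
    next
      fix F assume "F \<in> (\<lambda>A. A \<union> B) ` nsets T (k - card B)"
      then obtain A where A: "A \<subseteq> T" "finite A" "card A = k - card B" "F = A \<union> B"
        by (auto simp: nsets_def)
      then have "card F = k" using B finB cB
        by (subst A(4), subst card_Un_disjoint) auto
      moreover have "A \<noteq> {}" using A(3) cB by auto
      ultimately show "F \<in> {E. E \<in> ?X \<and> E - T = B}"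
        using A B finB T_subset u_notin_T by (auto simp: nsets_def)
    qed
    have "inj_on (\<lambda>A. A \<union> B) (nsets T (k - card B))"
      using B(1) by (intro inj_onI) (auto simp: nsets_def; blast)
    then show ?thesis
      using crossing_edges_with_outer_part[OF avg B cB] unfolding eq by (simp add: sum.reindex)
  qed
  then have "0 \<le> (\<Sum>B\<in>(\<lambda>E. E - T) ` ?X. sum ?h {E. E \<in> ?X \<and> E - T = B})"
    by (rule sum_nonneg)
  then show ?thesis by (subst sum.image_gen[OF finX, of _ "\<lambda>E. E - T"])
qed

text \<open>Hyperedges meeting the cluster fall into three classes: those through the pivot pay
  individually, whether cut or not; those inside \<open>T\<close> are uncut; those that meet
  \<open>T\<close> without the pivot and leave it are cut.\<close>

lemma ball_cluster:
  assumes avg: "(\<Sum>i\<in>T. d i) \<le> \<gamma> / 2 * real (card T)"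
  shows "0 \<le> (\<Sum>E | E \<in> nsets W k \<and> E \<inter> insert u T \<noteq> {}.
                lp E - \<gamma> / 2 * (if E \<subseteq> insert u T then wm E else wp E))"
    (is "0 \<le> sum ?h ?X")
proof -
  let ?U = "{E \<in> nsets W k. u \<in> E}"
  let ?C = "{E \<in> nsets W k. u \<notin> E \<and> E \<inter> T \<noteq> {} \<and> \<not> E \<subseteq> T}"
  have fins: "finite (nsets W k)" "finite (nsets T k)"
    using fin finite_T by (auto simp: finite_imp_finite_nsets)
  have X: "?X = ?U \<union> (nsets T k \<union> ?C)"
  proof -
    have "E \<inter> T \<noteq> {}" if "E \<in> nsets T k" for E
      using that k by (auto simp: nsets_def Int_absorb2)
    then show ?thesis using nsets_mono[OF T_subset] by (auto simp: nsets_def)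
  qed
  have "sum ?h ?X = sum ?h ?U + (sum ?h (nsets T k) + sum ?h ?C)"
  proof -
    have disj: "?U \<inter> (nsets T k \<union> ?C) = {}" "nsets T k \<inter> ?C = {}"
      using u_notin_T by (auto simp: nsets_def)
    have "finite ?U" "finite ?C" using fins by simp_all
    then show ?thesis unfolding X using fins disj by (simp add: sum.union_disjoint)
  qed
  moreover have "0 \<le> sum ?h ?U"
  proof (rule sum_nonneg)
    fix E assume E: "E \<in> ?U"
    show "0 \<le> ?h E"
    proof (cases "E \<subseteq> insert u T")
      case True
      then show ?thesis
        using E y_le_half_if_pivot_and_near[of E] lp_ge_wm[of E] \<gamma>_le by simp
    next
      case False
      then show ?thesis using E y_ge_if_pivot_and_far[of E] lp_ge_wp[of E] by simp
    qed
  qed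
  moreover have "sum ?h (nsets T k) = (\<Sum>E\<in>nsets T k. lp E - \<gamma> / 2 * wm E)"
    by (intro sum.cong) (auto simp: nsets_def)
  moreover have "sum ?h ?C = (\<Sum>E\<in>?C. lp E - \<gamma> / 2 * wp E)"
    by (intro sum.cong) auto
  ultimately show ?thesis using near_edges[OF avg] crossing_edges[OF avg] by simp
qed

end

section \<open>From the LP constraints to the whole loop\<close>

text \<open>The value at \<open>u\<close> is set to zero by hand because \<open>x {u, u}\<close> is
  \<open>x {u}\<close>, which the LP leaves unconstrained.\<close>

lemma pivot_step_of_lp_feasible:
  assumes feas: "lp_feasible V k x y" and W: "W \<subseteq> V" and "finite V" "u \<in> W" and k: "k \<ge> 2"
    and "motifcc_instance V k wp wm" and "\<forall>E \<in> nsets V k. wp E + wm E = 1"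
  shows "pivot_step W k u (\<lambda>i. if i = u then 0 else x {u, i}) wp wm y (1 / (2 * (real k - 1)))"
proof -
  let ?d = "\<lambda>i. if i = u then 0 else x {u, i}"
  note nV = subsetD[OF nsets_mono[OF W]]
  have x01: "0 \<le> x {i, j}" if "i \<in> W" "j \<in> W" "i \<noteq> j" for i j
    using feas W that unfolding lp_feasible_def by (metis doubleton_in_nsets_2 subsetD)
  have tri: "x {i, j} \<le> x {i, l} + x {j, l}"
    if "i \<in> W" "j \<in> W" "l \<in> W" "i \<noteq> j" "i \<noteq> l" "j \<noteq> l" for i j l
    using feas[unfolded lp_feasible_def, THEN conjunct1] W that by (simp add: subset_iff)
  have y01: "0 \<le> y E" "y E \<le> 1" if "E \<in> nsets W k" for E
    using feas nV[OF that] unfolding lp_feasible_def by auto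
  have edge: "x {i, j} \<le> y E" if "E \<in> nsets W k" "i \<in> E" "j \<in> E" "i \<noteq> j" for E i j
    using feas nV[OF that(1)] that unfolding lp_feasible_def by (elim conjE) simp
  have star: "x {i, j} \<le> ?d i + ?d j" if "i \<in> W" "j \<in> W" "i \<noteq> j" for i j
    using tri[of i j u] that \<open>u \<in> W\<close> by (auto simp: insert_commute)
  have upper: "y E \<le> (\<Sum>i\<in>E. ?d i)" if E: "E \<in> nsets W k" for E
  proof -
    have EW: "E \<subseteq> W" "finite E" "card E = k" using E by (auto simp: nsets_def)
    have "(real k - 1) * y E \<le> (\<Sum>p\<in>nsets E 2. x p)"
      using feas nV[OF E] unfolding lp_feasible_def by (elim conjE) simp
    also have "\<dots> \<le> (\<Sum>p\<in>nsets E 2. \<Sum>i\<in>p. ?d i)"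
    proof (rule sum_mono)
      fix p assume "p \<in> nsets E 2"
      then obtain i j where ij: "p = {i, j}" "i \<in> E" "j \<in> E" "i \<noteq> j"
        by (auto simp: nsets_2_eq)
      then have "x p \<le> ?d i + ?d j" using star[of i j] EW(1) unfolding ij(1) by (meson subsetD)
      also have "\<dots> = (\<Sum>i\<in>p. ?d i)" using ij by simp
      finally show "x p \<le> (\<Sum>i\<in>p. ?d i)" .
    qed
    \<comment> \<open>Each node lies in \<open>k - 1\<close> pairs, which matches the coefficient of
      \<open>y E\<close> in the LP constraint and cancels.\<close>
    also have "\<dots> = (real k - 1) * (\<Sum>i\<in>E. ?d i)"
      using EW k by (subst sum_nsets_sum) (auto simp: of_nat_diff)
    finally show ?thesis using k by simp
  qed
  have lower: "?d i - ?d j \<le> y E" if E: "E \<in> nsets W k" "i \<in> E" "j \<in> E" for E i j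
  proof -
    have ij: "i \<in> W" "j \<in> W" using E by (auto simp: nsets_def)
    have "0 \<le> ?d j" using x01[of u j] ij \<open>u \<in> W\<close> by auto
    moreover have "?d i - ?d j \<le> x {i, j}" if "i \<noteq> u" "i \<noteq> j"
      using tri[of u i j] that ij \<open>u \<in> W\<close> by (auto simp: insert_commute)
    moreover have "x {i, j} \<le> y E" if "i \<noteq> j" using edge[OF E that] .
    moreover have "0 \<le> y E" using y01[OF E(1)] by simp
    ultimately show ?thesis by (smt (verit))
  qed
  show ?thesis
  proof
    show "finite W" using assms(3) W finite_subset by blast
    show "(real k - 1) * (1 / (2 * (real k - 1))) = 1 / 2" using k by simp
    show "0 \<le> wp E" "0 \<le> wm E" "wp E + wm E = 1" if "E \<in> nsets W k" for E
      using assms(6,7) nV[OF that] unfolding motifcc_instance_def by auto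
  qed (use assms x01 y01 upper lower in auto)
qed

text \<open>The hyperedges within \<open>W\<close> that meet \<open>S\<close> are those settled by
  this iteration: later clusters avoid \<open>S\<close>, so such a hyperedge is either inside
  \<open>S\<close> or cut for good.\<close>

lemma cgw_cluster_charge:
  assumes feas: "lp_feasible V k x y" and W: "W \<subseteq> V" and fin: "finite V" and u: "u \<in> W"
    and k: "k \<ge> 2" and inst: "motifcc_instance V k wp wm"
    and prob: "\<forall>E \<in> nsets V k. wp E + wm E = 1"
    and S: "S = cgw_cluster (1 / (2 * (real k - 1))) (1 / 2) x W u"
  shows "(\<Sum>E | E \<in> nsets W k \<and> E \<inter> S \<noteq> {}. if E \<subseteq> S then wm E else wp E)
    \<le> 4 * (real k - 1) * (\<Sum>E | E \<in> nsets W k \<and> E \<inter> S \<noteq> {}. wp E * y E + wm E * (1 - y E))"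
    (is "sum ?c ?X \<le> _ * sum ?l ?X")
proof -
  define \<gamma> where "\<gamma> = 1 / (2 * (real k - 1))"
  define d where "d = (\<lambda>i. if i = u then 0 else x {u, i})"
  interpret pivot_step W k u d wp wm y \<gamma>
    unfolding \<gamma>_def d_def by (rule pivot_step_of_lp_feasible[OF feas W fin u k inst prob])
  have T: "cgw_ball \<gamma> x W u = T" unfolding T_def by (auto simp: cgw_ball_def d_def)
  have sT: "(\<Sum>i\<in>T. x {u, i}) = (\<Sum>i\<in>T. d i)"
    using u_notin_T by (intro sum.cong) (auto simp: d_def)
  have S': "S = (if (\<Sum>i\<in>T. d i) < \<gamma> / 2 * real (card T) then insert u T else {u})"
    unfolding S cgw_cluster_def \<gamma>_def[symmetric] T Let_def sT by simp
  have "0 \<le> (\<Sum>E\<in>?X. lp E - \<gamma> / 2 * ?c E)"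
  proof (cases "(\<Sum>i\<in>T. d i) < \<gamma> / 2 * real (card T)")
    case True
    then show ?thesis using ball_cluster S' by simp
  next
    case False
    then have Su: "S = {u}" using S' by simp
    have "(\<Sum>E\<in>?X. lp E - \<gamma> / 2 * ?c E) = (\<Sum>E | E \<in> nsets W k \<and> u \<in> E. lp E - \<gamma> / 2 * wp E)"
    proof (intro sum.cong)
      show "?X = {E \<in> nsets W k. u \<in> E}" using Su by auto
      show "lp E - \<gamma> / 2 * ?c E = lp E - \<gamma> / 2 * wp E" if "E \<in> {E \<in> nsets W k. u \<in> E}" for E
      proof -
        have "\<not> E \<subseteq> S"
          using that k card_mono[of "{u}" E] unfolding Su by (auto simp: nsets_def)
        then show ?thesis by simp
      qed
    qed
    then show ?thesis using singleton_cluster False by simp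
  qed
  then have "\<gamma> / 2 * sum ?c ?X \<le> sum ?l ?X"
    by (simp add: sum_subtractf sum_distrib_left lp_def)
  then have "4 * (real k - 1) * (\<gamma> / 2 * sum ?c ?X) \<le> 4 * (real k - 1) * sum ?l ?X"
    using k by (intro mult_left_mono) auto
  moreover have "4 * (real k - 1) * (\<gamma> / 2 * sum ?c ?X) = sum ?c ?X"
    using k by (simp add: \<gamma>_def)
  ultimately show ?thesis by argo
qed

text \<open>Each hyperedge is charged once, when the first cluster meeting it is formed. The LP
  solution on \<open>V\<close> stays fixed while \<open>W\<close> shrinks, so the charges add up to
  its objective.\<close>

lemma cgw_loop_cost_le:
  assumes "cgw_loop (1 / (2 * (real k - 1))) (1 / 2) x W P"
    and "W \<subseteq> V" and feas: "lp_feasible V k x y" and fin: "finite V"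
    and k: "k \<ge> 2" and inst: "motifcc_instance V k wp wm"
    and prob: "\<forall>E \<in> nsets V k. wp E + wm E = 1"
  shows "motifcc_cost W k wp wm P \<le> 4 * (real k - 1) * lp_objective W k wp wm y"
  using assms(1,2)
proof (induction rule: cgw_loop.induct)
  case finished
  have "nsets ({} :: 'a set) k = {}" using k by (simp add: nsets_empty_iff)
  then show ?case by (simp add: motifcc_cost_def lp_objective_def)
next
  case (pivot u W S P)
  let ?X = "{E \<in> nsets W k. E \<inter> S \<noteq> {}}"
  have finW: "finite W" using pivot.prems fin finite_subset by blast
  have split: "sum f (nsets W k) = sum f ?X + sum f (nsets (W - S) k)" for f :: "'a set \<Rightarrow> real"
  proof -
    have "nsets (W - S) k = nsets W k - ?X" by (auto simp: nsets_def)
    then show ?thesis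
      using sum.subset_diff[of ?X "nsets W k" f] finW by (simp add: finite_imp_finite_nsets)
  qed
  have sub: "C \<subseteq> W - S" if "C \<in> P" for C
    using cgw_loop_partition_on[OF pivot.hyps(3)] that unfolding partition_on_def by blast
  have ne: "E \<noteq> {}" if "E \<in> nsets A k" for E A using that k by (auto simp: nsets_def)
  let ?c = "\<lambda>P E. if \<exists>C\<in>P. E \<subseteq> C then wm E else wp E"
  have "sum (?c (insert S P)) ?X = (\<Sum>E\<in>?X. if E \<subseteq> S then wm E else wp E)"
    using sub by (intro sum.cong refl if_cong) blast
  moreover have "sum (?c (insert S P)) (nsets (W - S) k) = sum (?c P) (nsets (W - S) k)"
  proof (intro sum.cong refl if_cong)
    fix E assume E: "E \<in> nsets (W - S) k"
    then have "\<not> E \<subseteq> S" using ne[OF E] by (auto simp: nsets_def)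
    then show "(\<exists>C\<in>insert S P. E \<subseteq> C) = (\<exists>C\<in>P. E \<subseteq> C)" by blast
  qed
  ultimately have "motifcc_cost W k wp wm (insert S P) =
      (\<Sum>E\<in>?X. if E \<subseteq> S then wm E else wp E) + motifcc_cost (W - S) k wp wm P"
    unfolding motifcc_cost_def split by simp
  also have "\<dots> \<le> 4 * (real k - 1) * (\<Sum>E\<in>?X. wp E * y E + wm E * (1 - y E))
      + 4 * (real k - 1) * lp_objective (W - S) k wp wm y"
    using cgw_cluster_charge[OF feas pivot.prems fin pivot.hyps(1) k inst prob pivot.hyps(2)]
      pivot.IH pivot.prems by (intro add_mono) auto
  also have "\<dots> = 4 * (real k - 1) * lp_objective W k wp wm y"
    unfolding lp_objective_def split by (simp add: distrib_left)
  finally show ?case .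
qed

section \<open>The LP optimum as a lower bound\<close>

lemma card_split_pairs_ge:
  assumes "finite E" "A \<subseteq> E" "A \<noteq> {}" "E - A \<noteq> {}"
  shows "card E - 1 \<le> card {p \<in> nsets E 2. p \<inter> A \<noteq> {} \<and> \<not> p \<subseteq> A}"
proof -
  obtain a b where ab: "a \<in> A" "b \<in> E - A" using assms(3,4) by blast
  \<comment> \<open>Every node is paired with a fixed node on the other side. Both \<open>a\<close>
    and \<open>b\<close> would give the pair \<open>{a, b}\<close>, so \<open>b\<close> is left out
    and \<open>card E - 1\<close> distinct pairs remain.\<close>
  let ?f = "\<lambda>i. if i \<in> A then {b, i} else {a, i}"
  have "inj_on ?f (E - {b})"
  proof (rule inj_onI)
    fix i j assume "i \<in> E - {b}" "j \<in> E - {b}" "?f i = ?f j"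
    then show "i = j" using ab by (auto simp: doubleton_eq_iff split: if_splits)
  qed
  moreover have "?f ` (E - {b}) \<subseteq> {p \<in> nsets E 2. p \<inter> A \<noteq> {} \<and> \<not> p \<subseteq> A}"
    using ab assms(2) by auto
  moreover have "finite {p \<in> nsets E 2. p \<inter> A \<noteq> {} \<and> \<not> p \<subseteq> A}"
    using assms(1) by (simp add: finite_imp_finite_nsets)
  ultimately have "card (E - {b}) \<le> card {p \<in> nsets E 2. p \<inter> A \<noteq> {} \<and> \<not> p \<subseteq> A}"
    by (rule card_inj_on_le)
  then show ?thesis using ab assms(1) by simp
qed

text \<open>The integral LP point of a clustering; one function supplies both the pair and the
  hyperedge variables.\<close>

definition partition_lp :: "'a set set \<Rightarrow> 'a set \<Rightarrow> real" where
  "partition_lp Q E = (if \<exists>C\<in>Q. E \<subseteq> C then 0 else 1)"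

text \<open>The triangle inequality is transitivity of lying in one cluster. A hyperedge that is cut
  is split by the cluster of any of its nodes, so at least \<open>k - 1\<close> of its pairs are
  separated, as the lower bound on the pair sum demands.\<close>

lemma partition_lp_feasible:
  assumes Q: "partition_on V Q" and k: "k \<ge> 2"
  shows "lp_feasible V k (partition_lp Q) (partition_lp Q)"
proof -
  have uniq: "C = D" if "C \<in> Q" "D \<in> Q" "w \<in> C" "w \<in> D" for C D w
    using Q that unfolding partition_on_def disjoint_def by blast
  have tri: "partition_lp Q {u, v} \<le> partition_lp Q {u, w} + partition_lp Q {v, w}" for u v w
  proof (cases "(\<exists>C\<in>Q. {u, w} \<subseteq> C) \<and> (\<exists>C\<in>Q. {v, w} \<subseteq> C)")
    case True
    then obtain C D where "C \<in> Q" "u \<in> C" "w \<in> C" "D \<in> Q" "v \<in> D" "w \<in> D" by auto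
    moreover from this have "C = D" using uniq by blast
    ultimately have "\<exists>C\<in>Q. {u, v} \<subseteq> C" by auto
    then show ?thesis by (simp add: partition_lp_def)
  qed (auto simp: partition_lp_def)
  have mono: "partition_lp Q {u, v} \<le> partition_lp Q E" if "u \<in> E" "v \<in> E" for u v E
  proof -
    have "{u, v} \<subseteq> C" if "E \<subseteq> C" for C using that \<open>u \<in> E\<close> \<open>v \<in> E\<close> by blast
    then show ?thesis by (auto simp: partition_lp_def)
  qed
  have pairs: "(real k - 1) * partition_lp Q E \<le> (\<Sum>p\<in>nsets E 2. partition_lp Q p)"
    if E: "E \<in> nsets V k" for E
  proof (cases "\<exists>C\<in>Q. E \<subseteq> C")
    case True
    then show ?thesis by (simp add: partition_lp_def sum_nonneg)
  next
    case False
    have EV: "E \<subseteq> V" "finite E" "card E = k" using E by (auto simp: nsets_def)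
    then obtain a where a: "a \<in> E" using k by fastforce
    then obtain C where C: "C \<in> Q" "a \<in> C" using EV(1) Q unfolding partition_on_def by blast
    let ?A = "E \<inter> C"
    let ?N = "{p \<in> nsets E 2. p \<inter> ?A \<noteq> {} \<and> \<not> p \<subseteq> ?A}"
    have "card E - 1 \<le> card ?N"
      using False a C EV by (intro card_split_pairs_ge) auto
    then have "real k - 1 \<le> real (card ?N)" using EV k by linarith
    also have "\<dots> = (\<Sum>p\<in>?N. partition_lp Q p)"
    proof -
      have "partition_lp Q p = 1" if p: "p \<in> ?N" for p
      proof -
        obtain i j where "i \<in> p" "i \<in> C" "j \<in> p" "j \<notin> C" using p by (auto simp: nsets_def)
        then have "\<not> (\<exists>D\<in>Q. p \<subseteq> D)" using uniq[OF C(1)] by blast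
        then show ?thesis by (simp add: partition_lp_def)
      qed
      then show ?thesis by simp
    qed
    also have "\<dots> \<le> (\<Sum>p\<in>nsets E 2. partition_lp Q p)"
      using EV(2) by (intro sum_mono2) (auto simp: finite_imp_finite_nsets partition_lp_def)
    finally show ?thesis using False by (simp add: partition_lp_def)
  qed
  have "0 \<le> partition_lp Q E \<and> partition_lp Q E \<le> 1" for E by (simp add: partition_lp_def)
  then show ?thesis unfolding lp_feasible_def using tri mono pairs by simp
qed

lemma lp_objective_partition_lp:
  "lp_objective V k wp wm (partition_lp Q) = motifcc_cost V k wp wm Q"
  unfolding lp_objective_def motifcc_cost_def by (intro sum.cong) (auto simp: partition_lp_def)

lemma lp_optimal_le_motifcc_opt:
  assumes "lp_optimal V k wp wm x y" "finite V" "k \<ge> 2"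
  shows "lp_objective V k wp wm y \<le> motifcc_opt V k wp wm"
proof -
  \<comment> \<open>The partition into singletons shows that the minimum is over a nonempty set and
    hence attained.\<close>
  have "partition_on V ((\<lambda>v. {v}) ` V)" by (auto simp: partition_on_def disjoint_def)
  then have "motifcc_opt V k wp wm \<in> motifcc_cost V k wp wm ` {P. partition_on V P}"
    unfolding motifcc_opt_def using finitely_many_partition_on[OF assms(2)]
    by (intro Min_in) auto
  then obtain Q where Q: "partition_on V Q" "motifcc_opt V k wp wm = motifcc_cost V k wp wm Q"
    by blast
  then have "lp_objective V k wp wm y \<le> lp_objective V k wp wm (partition_lp Q)"
    using assms(1) partition_lp_feasible[OF Q(1) assms(3)]
    unfolding lp_optimal_def is_arg_min_linorder by auto
  then show ?thesis using Q(2) by (simp add: lp_objective_partition_lp)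
qed

theorem theorem4:
  fixes V :: "'a set" and k :: nat and wp wm :: "'a set \<Rightarrow> real" and P :: "'a set set"
  assumes "k \<ge> 2"
    and "motifcc_instance V k wp wm"
    and "\<forall>E \<in> nsets V k. wp E + wm E = 1"
    and "cgw_output V k wp wm (1 / (2 * (real k - 1))) (1 / 2) P"
  shows "motifcc_cost V k wp wm P \<le> 4 * (real k - 1) * motifcc_opt V k wp wm"
proof -
  obtain x y where opt: "lp_optimal V k wp wm x y"
    and loop: "cgw_loop (1 / (2 * (real k - 1))) (1 / 2) x V P"
    using assms(4) unfolding cgw_output_def by blast
  have fin: "finite V" using assms(2) by (simp add: motifcc_instance_def)
  have feas: "lp_feasible V k x y"
    using opt by (simp add: lp_optimal_def is_arg_min_def)
  have "motifcc_cost V k wp wm P \<le> 4 * (real k - 1) * lp_objective V k wp wm y"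
    using cgw_loop_cost_le[OF loop subset_refl feas fin assms(1-3)] .
  also have "\<dots> \<le> 4 * (real k - 1) * motifcc_opt V k wp wm"
    using lp_optimal_le_motifcc_opt[OF opt fin assms(1)] assms(1) by (intro mult_left_mono) auto
  finally show ?thesis .
qed

end
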